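(* Let $\succcurlyeq$ be a transitive binary relation on a real vector space $X$. Then: (a) $\succcurlyeq$ is additive and homothetic if and only if it is independent. (b) If $\succcurlyeq$ is complete and mixture-continuous, then it is additive if and only if it is independent.
   Context: Additive: for all $x,y,z\in X$, $x\succcurlyeq y$ if and only if $x+z\succcurlyeq y+z$. Homothetic: for all $x,y\in X$ and all real $\lambda>0$, $x\succcurlyeq y$ implies $\lambda x\succcurlyeq\lambda y$. Independent: for all $x,y,z\in X$ and all $\lambda\in(0,1)$, $x\succcurlyeq y$ implies $\lambda x+(1-\lambda)z\succcurlyeq\lambda y+(1-\lambda)z$. Complete: $x\succcurlyeq y$ or $y\succcurlyeq x$ for all $x,y\in X$. Mixture-continuous: for all $x,y,z\in X$, the sets $\{\lambda\in[0,1]:\lambda x+(1-\lambda)y\succcurlyeq z\}$ and $\{\lambda\in[0,1]:z\succcurlyeq\lambda x+(1-\lambda)y\}$ are closed. *)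

theory Defs
  imports Complex_Main
begin

definition additive_rel :: "('a::real_vector \<Rightarrow> 'a \<Rightarrow> bool) \<Rightarrow> bool" where
  "additive_rel R \<longleftrightarrow> (\<forall>x y z. R x y \<longleftrightarrow> R (x + z) (y + z))"

definition homothetic_rel :: "('a::real_vector \<Rightarrow> 'a \<Rightarrow> bool) \<Rightarrow> bool" where
  "homothetic_rel R \<longleftrightarrow> (\<forall>x y. \<forall>l::real. l > 0 \<longrightarrow> R x y \<longrightarrow> R (l *\<^sub>R x) (l *\<^sub>R y))"

definition independent_rel :: "('a::real_vector \<Rightarrow> 'a \<Rightarrow> bool) \<Rightarrow> bool" where
  "independent_rel R \<longleftrightarrow>
     (\<forall>x y z. \<forall>l\<in>{0<..<1::real}. R x y \<longrightarrow>
        R (l *\<^sub>R x + (1 - l) *\<^sub>R z) (l *\<^sub>R y + (1 - l) *\<^sub>R z))"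

text \<open>Completeness includes the case \<open>x = y\<close>, hence reflexivity; the library's
  \<^const>\<open>totalp\<close> only compares distinct elements.\<close>

definition complete_rel :: "('a \<Rightarrow> 'a \<Rightarrow> bool) \<Rightarrow> bool" where
  "complete_rel R \<longleftrightarrow> (\<forall>x y. R x y \<or> R y x)"

text \<open>Being closed in \<open>[0,1]\<close> and being closed in the real line agree for subsets
  of \<open>[0,1]\<close>.\<close>

definition mixture_continuous_rel :: "('a::real_vector \<Rightarrow> 'a \<Rightarrow> bool) \<Rightarrow> bool" where
  "mixture_continuous_rel R \<longleftrightarrow>
     (\<forall>x y z. closed {l\<in>{0..1::real}. R (l *\<^sub>R x + (1 - l) *\<^sub>R y) z} \<and>
              closed {l\<in>{0..1::real}. R z (l *\<^sub>R x + (1 - l) *\<^sub>R y)})"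

end

theory Submission imports Defs begin

text \<open>Additivity says that \<open>R x y\<close> only depends on \<open>x - y\<close>, and homothety that the differences
  form a cone. Independence turns \<open>R x y\<close> into \<open>R (w + l (x - y)) w\<close> for all \<open>w\<close> and all
  \<open>l \<in> (0,1)\<close>; chaining \<open>n\<close> such steps by transitivity reaches every positive multiple of
  \<open>x - y\<close>. In (b), additivity and completeness give \<open>R (q (x - y)) 0\<close> for positive
  rational \<open>q\<close>, and mixture continuity extends this to real factors in \<open>(0,1)\<close>.\<close>

lemma transp_translate_multiple:
  fixes R :: "'a::real_vector \<Rightarrow> 'a \<Rightarrow> bool"
  assumes "transp R" and step: "\<And>w. R (w + d) w" and "n > 0"
  shows "R (w + real n *\<^sub>R d) w"
  using \<open>n > 0\<close>
proof (induction n rule: nat_induct_non_zero)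
  case 1
  show ?case using step by simp
next
  case (Suc n)
  have "R (w + real n *\<^sub>R d + d) (w + real n *\<^sub>R d)" by (rule step)
  then have "R (w + real n *\<^sub>R d + d) w" using Suc.IH \<open>transp R\<close> by (blast dest: transpD)
  then show ?case by (simp add: algebra_simps)
qed

lemma independent_rel_translate_scale:
  fixes R :: "'a::real_vector \<Rightarrow> 'a \<Rightarrow> bool"
  assumes "transp R" and ind: "independent_rel R" and "R x y" and "k > 0"
  shows "R (w + k *\<^sub>R (x - y)) w"
proof -
  have small: "R (v + l *\<^sub>R (x - y)) v" if "0 < l" "l < 1" for v l
  proof -
    \<comment> \<open>This \<open>z\<close> solves
      \<open>l *\<^sub>R y + (1 - l) *\<^sub>R z = v\<close>, so mixing \<open>y\<close> with it
      lands on the prescribed base point \<open>v\<close>.\<close>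
    define z where "z = (1 / (1 - l)) *\<^sub>R (v - l *\<^sub>R y)"
    have z: "(1 - l) *\<^sub>R z = v - l *\<^sub>R y" using that by (simp add: z_def)
    have "R (l *\<^sub>R x + (1 - l) *\<^sub>R z) (l *\<^sub>R y + (1 - l) *\<^sub>R z)"
      using ind \<open>R x y\<close> that unfolding independent_rel_def by simp
    then show ?thesis unfolding z by (simp add: algebra_simps)
  qed
  \<comment> \<open>With \<open>n\<close> above \<open>k\<close>, the step factor
    \<open>k / real n\<close> lies in (0,1), where \<open>small\<close> applies.\<close>
  obtain n :: nat where n: "k < real n" using reals_Archimedean2 by blast
  then have "n > 0" using \<open>k > 0\<close> by (cases n) auto
  have "R (w + real n *\<^sub>R ((k / real n) *\<^sub>R (x - y))) w"
    using n \<open>n > 0\<close> \<open>k > 0\<close> by (intro transp_translate_multiple[OF \<open>transp R\<close>] small) auto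
  then show ?thesis using \<open>n > 0\<close> by simp
qed

lemma additive_rel_diff_iff: "additive_rel R \<Longrightarrow> R x y \<longleftrightarrow> R (x - y) 0"
  unfolding additive_rel_def by (metis add_0 diff_add_cancel)

lemma additive_rel_if_independent_rel:
  assumes "transp R" and "independent_rel R"
  shows "additive_rel R"
  unfolding additive_rel_def
proof (intro allI iffI)
  fix x y z
  show "R (x + z) (y + z)" if "R x y"
    using independent_rel_translate_scale[OF assms that, of 1 "y + z"] by (simp add: algebra_simps)
  \<comment> \<open>Cancelling \<open>z\<close> is again a translation, since both pairs have the
    same difference; only the base point changes to \<open>y\<close>.\<close>
  show "R x y" if "R (x + z) (y + z)"
    using independent_rel_translate_scale[OF assms that, of 1 y] by (simp add: algebra_simps)
qed

lemma homothetic_rel_if_independent_rel: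
  assumes "transp R" and "independent_rel R"
  shows "homothetic_rel R"
  unfolding homothetic_rel_def
proof (intro allI impI)
  fix x y and l :: real
  assume "l > 0" "R x y"
  then show "R (l *\<^sub>R x) (l *\<^sub>R y)"
    using independent_rel_translate_scale[OF assms, of x y l "l *\<^sub>R y"] by (simp add: algebra_simps)
qed

text \<open>Shared by both parts: the common term with \<open>z\<close> drops out of the difference,
  so only shrinking of differences is left to check. Homothety supplies \<open>scale\<close> in (a),
  mixture continuity in (b).\<close>

lemma independent_rel_if_additive_rel:
  assumes "additive_rel R"
    and scale: "\<And>d l. R d 0 \<Longrightarrow> 0 < l \<Longrightarrow> l < 1 \<Longrightarrow> R (l *\<^sub>R d) 0"
  shows "independent_rel R"
  unfolding independent_rel_def
proof (intro allI ballI impI)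
  fix x y z and l :: real
  assume l: "l \<in> {0<..<1}" and "R x y"
  then have "R (l *\<^sub>R (x - y)) 0"
    using scale additive_rel_diff_iff[OF assms(1)] by auto
  then show "R (l *\<^sub>R x + (1 - l) *\<^sub>R z) (l *\<^sub>R y + (1 - l) *\<^sub>R z)"
    by (subst additive_rel_diff_iff[OF assms(1)]) (simp add: algebra_simps)
qed

lemma additive_rel_nonneg_rational_multiple:
  assumes "transp R" and add: "additive_rel R" and compl: "complete_rel R"
    and "R d 0" and "n > 0"
  shows "R ((real m / real n) *\<^sub>R d) 0"
proof -
  have translate: "R (w + e) w \<longleftrightarrow> R e 0" "R w (w + e) \<longleftrightarrow> R 0 e" for w e
    using add unfolding additive_rel_def by (metis add.commute add_0)+
  have multiple: "R (real j *\<^sub>R e) 0" if "R e 0" for j e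
  proof (cases "j = 0")
    case True
    \<comment> \<open>The zero multiple needs \<open>R 0 0\<close>, which is reflexivity from
      completeness.\<close>
    then show ?thesis using compl unfolding complete_rel_def by auto
  next
    case False
    then show ?thesis
      using transp_translate_multiple[OF \<open>transp R\<close>, of e j 0] that translate(1) by simp
  qed
  define e where "e = (1 / real n) *\<^sub>R d"
  have d: "d = real n *\<^sub>R e" using \<open>n > 0\<close> by (simp add: e_def)
  have "R e 0"
  proof (rule ccontr)
    assume "\<not> R e 0"
    then have "R 0 e" using compl unfolding complete_rel_def by blast
    then have "R (- e) 0" using additive_rel_diff_iff[OF add, of 0 e] by simp
    \<comment> \<open>Taking \<open>n - 1\<close> copies rather than \<open>n\<close> gives
      \<open>R e d\<close>, which chains with \<open>R d 0\<close> to the excluded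
      \<open>R e 0\<close>; \<open>n\<close> copies would only give \<open>R 0 d\<close>, which is
      no contradiction.\<close>
    then have "R (real (n - 1) *\<^sub>R (- e)) 0" by (rule multiple)
    moreover have "real (n - 1) *\<^sub>R (- e) = e - d"
      using \<open>n > 0\<close> by (simp add: d of_nat_diff algebra_simps)
    ultimately have "R e d" using additive_rel_diff_iff[OF add, of e d] by simp
    with \<open>R d 0\<close> \<open>transp R\<close> \<open>\<not> R e 0\<close> show False by (blast dest: transpD)
  qed
  then have "R (real m *\<^sub>R e) 0" by (rule multiple)
  then show ?thesis by (simp add: e_def)
qed

lemma additive_rel_scale_if_mixture_continuous_rel:
  assumes "transp R" and "additive_rel R" and "complete_rel R" and mc: "mixture_continuous_rel R"
    and "R d 0" and l: "0 < l" "l < 1"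
  shows "R (l *\<^sub>R d) 0"
proof -
  \<comment> \<open>Mixing \<open>d\<close> with 0 turns scaling into a mixture, so continuity
    applies.\<close>
  define S where "S = {l\<in>{0..1::real}. R (l *\<^sub>R d + (1 - l) *\<^sub>R 0) 0}"
  have "closed S" using mc unfolding mixture_continuous_rel_def S_def by blast
  have "l \<in> S"
  proof (rule ccontr)
    assume "l \<notin> S"
    with \<open>closed S\<close> obtain \<epsilon> where "\<epsilon> > 0" and disjoint: "\<And>y. dist y l < \<epsilon> \<Longrightarrow> y \<notin> S"
      unfolding closed_def open_dist by force
    \<comment> \<open>Approximating \<open>l\<close> from below, cut off at 0, keeps the rational
      \<open>q\<close> inside [0,1].\<close>
    from \<open>\<epsilon> > 0\<close> have "max 0 (l - \<epsilon>) < l" using l by simp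
    then obtain q where q: "q \<in> \<rat>" "max 0 (l - \<epsilon>) < q" "q < l"
      using Rats_dense_in_real by blast
    then obtain m n :: nat where "n \<noteq> 0" "\<bar>q\<bar> = real m / real n"
      by (elim Rats_abs_nat_div_natE)
    then have "R (q *\<^sub>R d) 0"
      using additive_rel_nonneg_rational_multiple[OF assms(1-3) \<open>R d 0\<close>, of n m] q by simp
    then have "q \<in> S" using q l by (simp add: S_def)
    moreover have "dist q l < \<epsilon>" using q by (simp add: dist_real_def)
    ultimately show False using disjoint by blast
  qed
  then show ?thesis by (simp add: S_def)
qed

theorem proposition4:
  fixes R :: "'a::real_vector \<Rightarrow> 'a \<Rightarrow> bool"
  assumes "transp R"
  shows "(additive_rel R \<and> homothetic_rel R \<longleftrightarrow> independent_rel R) \<and>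
         (complete_rel R \<and> mixture_continuous_rel R \<longrightarrow> (additive_rel R \<longleftrightarrow> independent_rel R))"
proof (intro conjI impI iffI)
  assume "additive_rel R \<and> homothetic_rel R"
  \<comment> \<open>Homothety applied to \<open>R d 0\<close> fixes the right-hand side, as
    multiples of 0 are 0.\<close>
  then show "independent_rel R"
    unfolding homothetic_rel_def
    by (metis independent_rel_if_additive_rel scaleR_zero_right)
next
  assume "complete_rel R \<and> mixture_continuous_rel R" "additive_rel R"
  then show "independent_rel R"
    by (blast intro: independent_rel_if_additive_rel
        additive_rel_scale_if_mixture_continuous_rel[OF assms])
qed (use assms additive_rel_if_independent_rel homothetic_rel_if_independent_rel in blast)+

end
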